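(* Let $N$ be the event-activity network of a line network $(G,\mathcal L)$, let $T\in\mathbb N$, $T\ge1$, be a period, and let $l,u\in\mathbb Z^{A(N)}$, $l\le u$. Let $(x^\circ,z^\circ)\in P_{LP}(\mathrm{cXPESP})$ and $(\pi,p)=\psi(\varphi(x^\circ,z^\circ))\in P_{LP}(\mathrm{PESP})$. Denote by $\Gamma$ the set of line cycles in $N$. If $\mathbf x$ is the periodic tension corresponding to $(\pi,p)$, i.e. $\mathbf x_\alpha=\pi_w-\pi_v+Tp_\alpha$ for $\alpha=(v,w)\in A(N)$, then for each $\gamma\in\Gamma$ the following hold: 1. the cycle inequality $$\left\lceil\frac{\gamma_+^\top l-\gamma_-^\top u}{T}\right\rceil\le\frac{\gamma^\top\mathbf x}{T}\le\left\lfloor\frac{\gamma_+^\top u-\gamma_-^\top l}{T}\right\rfloor;$$ 2. the change-cycle inequality $$(T-\xi)\gamma_+^\top(\mathbf x-l)+\xi\gamma_-^\top(\mathbf x-l)\ge\xi(T-\xi),\qquad \xi=[-\gamma^\top l]_T;$$ 3. the flip-cycle inequality, for every $F\subseteq A(N)$, $$(T-\xi_F)\sum_{a\in A(N)\setminus F:\gamma_a=1}(\mathbf x_a-l_a)+\xi_F\sum_{a\in A(N)\setminus F:\gamma_a=-1}(\mathbf x_a-l_a)+\xi_F\sum_{a\in F:\gamma_a=1}(u_a-\mathbf x_a)+(T-\xi_F)\sum_{a\in F:\gamma_a=-1}(u_a-\mathbf x_a)\ge\xi_F(T-\xi_F),$$ where $\xi_F=\big[-\sum_{a\in A(N)\setminus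 F}\gamma_al_a-\sum_{a\in F}\gamma_au_a\big]_T$.
   Context: **Notation.** $[k]_T$ and $k\bmod T$ denote the residue of the integer $k$ modulo $T$ in $[T]=\{0,\dots,T-1\}$. An oriented cycle is regarded as a vector $\gamma\in\{0,1,-1\}^{A(N)}$, decomposed as $\gamma=\gamma_+-\gamma_-$ into its positive and negative parts; a line cycle is identified with its incidence vector, so for line cycles $\gamma=\gamma_+$ and $\gamma_-=0$. **Event-activity network.** A line network is a finite undirected graph $G$ with a finite set $\mathcal L$ of lines, each line $L=(v_1,\dots,v_n)$ being a path in $G$ with at least one edge. The event-activity network $N$ is the directed graph whose nodes are called events and whose arcs are called activities. For each line $L=(v_1,\dots,v_n)$ and each $1\le i\le n-1$ it has events $(v_i,L,dep,+)$, $(v_{i+1},L,arr,+)$, $(v_{i+1},L,dep,-)$, $(v_i,L,arr,-)$ and driving activities $((v_i,L,dep,+),(v_{i+1},L,arr,+))$, $((v_{i+1},L,dep,-),(v_i,L,arr,-))$; for each stop $v$ of $L$ and $s\in\{+,-\}$ a waiting activity $((v,L,arr,s),(v,L,dep,s))$ if both events exist; turnaround activities $((v_1,L,arr,-),(v_1,L,dep,+))$ and $((v_n,L,arr,+),(v_n,L,dep,-))$; and for every ordered pair of distinct lines $L,L'$, every common stop $v$ and $s_1,s_2\in\{+,-\}$ a transfer activity $((v,L,arr,s_1),(v,L',dep,s_2))$ if both events exist. $V(N),A(N)$ are the sets of events and activities, $X(N)$ the set of vehicle activities (driving, waiting, turnaround), $Z(N)$ the set of transfer activities. The line cycle $\gamma_L$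 is the directed cycle in $N$ formed by all events and vehicle activities of $L$. **Expanded network.** $V(D)=\{v[t] : v\in V(N),t\in[T]\}$. For $\alpha=(v,w)\in A(N)$ let $\mathcal A(\alpha)=\{(v[t],w[t']) : t,t'\in[T],\ (t'-t-l_\alpha)\bmod T\le u_\alpha-l_\alpha\}$, and $A(D)=\bigcup_\alpha \mathcal A(\alpha)$. The duration of $a=(v[t],w[t'])\in\mathcal A(\alpha)$ is $\tau_a=((t'-t-l_\alpha)\bmod T)+l_\alpha$. $X(D)=\bigcup_{\alpha\in X(N)}\mathcal A(\alpha)$, $Z(D)=\bigcup_{\alpha\in Z(N)}\mathcal A(\alpha)$. $\delta^{+}_S(v)$, $\delta^-_S(v)$ are the outgoing, respectively ingoing, arcs of $v$ in $S\subseteq A(D)$. The expanded line cycle of $L$ is $D$ restricted to the nodes $v[t]$ with $v\in V(\gamma_L)$, $t\in[T]$. A cycle of $L$ is a closed (directed, simple) path $c$ in the expanded line cycle with $|V(c)|=|V(\gamma_L)|$; $C_L$ is the set of cycles of $L$ and $C=\bigcup_{L}C_L$. **Polyhedra.** $P_{LP}(\mathrm{PESP})$: all $(\pi,p)\in\mathbb Q^{V(N)}\times\mathbb Q^{A(N)}$ with $l_\alpha\le \pi_w-\pi_v+Tp_\alpha\le u_\alpha$ for all $\alpha=(v,w)\in A(N)$ and $0\le\pi_v\le T-1$ for all $v\in V(N)$. $P_{LP}(\mathrm{cXPESP})$: all $(x,z)\in\mathbb Q^{C}\times\mathbb Q^{Z(D)}$ with nonnegative entries such that $\sum_{c\in C_L}x_c=1$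 for all $L\in\mathcal L$, and for all $\alpha=(v,w)\in Z(N)$, $t\in[T]$: $\sum_{c\in C: v[t]\in c}x_c=\sum_{a\in\delta^+_{\mathcal A(\alpha)}(v[t])}z_a$ and $\sum_{c\in C: w[t]\in c}x_c=\sum_{a\in\delta^-_{\mathcal A(\alpha)}(w[t])}z_a$. **Maps.** $\varphi:\mathbb Q^C\times\mathbb Q^{Z(D)}\to\mathbb Q^{X(D)}\times\mathbb Q^{Z(D)}$, $\varphi(x,z)=(\bar x,z)$ with $\bar x_a=\sum_{c\in C:a\in c}x_c$. $\psi:\mathbb Q^{X(D)}\times\mathbb Q^{Z(D)}\to\mathbb Q^{V(N)}\times\mathbb Q^{A(N)}$, $\psi(x,z)=(\pi,p)$ with $\pi_v=\sum_{t\in[T]}\ \sum_{a\in\delta^+_{X(D)}(v[t])}t\,x_a$ and $p_\alpha=\sum_{a=(v[t],w[t'])\in\mathcal A(\alpha)}\frac{\tau_a-(t'-t)}{T}\,y_a$, where $y_a=x_a$ for $a\in X(D)$ and $y_a=z_a$ for $a\in Z(D)$. *)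

theory Defs
  imports Complex_Main "Graph_Theory.Graph_Theory"
begin

section \<open>Line networks and event-activity networks\<close>

text \<open>
  An undirected graph is a symmetric loop-free digraph (\<^locale>\<open>pair_graph\<close>). A line is its
  sequence of stops, so a path and its reversal count as different lines.
\<close>

locale line_network = pair_graph G for G :: "'v pair_pre_digraph" +
  fixes LL :: "'v list set"
  assumes finite_lines: "finite LL"
    and line_path: "L \<in> LL \<Longrightarrow> vpath L (with_proj G)"
    and line_has_edge: "L \<in> LL \<Longrightarrow> vwalk_length L \<ge> 1"

datatype kind = Dep | Arr

datatype direction = Fwd | Bwd

type_synonym 'v event = "'v \<times> 'v list \<times> kind \<times> direction"
type_synonym 'v activity = "'v event \<times> 'v event"

definition line_events :: "'v list \<Rightarrow> 'v event set" where
  "line_events L = (\<Union>i\<in>{i. Suc i < length L}.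
     {(L ! i, L, Dep, Fwd), (L ! Suc i, L, Arr, Fwd),
      (L ! Suc i, L, Dep, Bwd), (L ! i, L, Arr, Bwd)})"

definition driving :: "'v list \<Rightarrow> 'v activity set" where
  "driving L = (\<Union>i\<in>{i. Suc i < length L}.
     {((L ! i, L, Dep, Fwd), (L ! Suc i, L, Arr, Fwd)),
      ((L ! Suc i, L, Dep, Bwd), (L ! i, L, Arr, Bwd))})"

definition waiting :: "'v list \<Rightarrow> 'v activity set" where
  "waiting L = {((v, L, Arr, s), (v, L, Dep, s)) | v s.
     v \<in> set L \<and> (v, L, Arr, s) \<in> line_events L \<and> (v, L, Dep, s) \<in> line_events L}"

definition turnaround :: "'v list \<Rightarrow> 'v activity set" where
  "turnaround L = {((hd L, L, Arr, Bwd), (hd L, L, Dep, Fwd)),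
                   ((last L, L, Arr, Fwd), (last L, L, Dep, Bwd))}"

definition line_activities :: "'v list \<Rightarrow> 'v activity set" where
  "line_activities L = driving L \<union> waiting L \<union> turnaround L"

definition vehicle_activities :: "'v list set \<Rightarrow> 'v activity set" where
  "vehicle_activities LL = (\<Union>L\<in>LL. line_activities L)"

definition transfer_activities :: "'v list set \<Rightarrow> 'v activity set" where
  "transfer_activities LL = {((v, L, Arr, s1), (v, L', Dep, s2)) | v L L' s1 s2.
     L \<in> LL \<and> L' \<in> LL \<and> L \<noteq> L' \<and> v \<in> set L \<inter> set L' \<and>
     (v, L, Arr, s1) \<in> line_events L \<and> (v, L', Dep, s2) \<in> line_events L'}"

text \<open>
  The event-activity network has no parallel activities, so activities are pairs of events.
\<close>

definition network :: "'v list set \<Rightarrow> 'v event pair_pre_digraph" where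
  "network LL = \<lparr> pverts = (\<Union>L\<in>LL. line_events L),
                  parcs = vehicle_activities LL \<union> transfer_activities LL \<rparr>"

abbreviation events :: "'v list set \<Rightarrow> 'v event set" where
  "events LL \<equiv> pverts (network LL)"

abbreviation activities :: "'v list set \<Rightarrow> 'v activity set" where
  "activities LL \<equiv> parcs (network LL)"

text \<open>The node set of the line cycle of \<open>L\<close> is \<^term>\<open>line_events L\<close>; its incidence vector is:\<close>

definition line_cycle :: "'v list \<Rightarrow> 'v activity \<Rightarrow> int" where
  "line_cycle L \<alpha> = (if \<alpha> \<in> line_activities L then 1 else 0)"

definition line_cycles :: "'v list set \<Rightarrow> ('v activity \<Rightarrow> int) set" where
  "line_cycles LL = line_cycle ` LL"

definition pos_part :: "('a \<Rightarrow> int) \<Rightarrow> 'a \<Rightarrow> int" where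
  "pos_part \<gamma> \<alpha> = max (\<gamma> \<alpha>) 0"

definition neg_part :: "('a \<Rightarrow> int) \<Rightarrow> 'a \<Rightarrow> int" where
  "neg_part \<gamma> \<alpha> = max (- \<gamma> \<alpha>) 0"


section \<open>The expanded network\<close>

type_synonym 'v xnode = "'v event \<times> nat"
type_synonym 'v xarc = "'v xnode \<times> 'v xnode"

definition expanded_arcs ::
    "nat \<Rightarrow> ('v activity \<Rightarrow> int) \<Rightarrow> ('v activity \<Rightarrow> int) \<Rightarrow> 'v activity \<Rightarrow> 'v xarc set" where
  "expanded_arcs T l u \<alpha> = {((fst \<alpha>, t), (snd \<alpha>, t')) | t t'. t < T \<and> t' < T \<and>
     (int t' - int t - l \<alpha>) mod int T \<le> u \<alpha> - l \<alpha>}"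

text \<open>
  The sets \<^term>\<open>expanded_arcs T l u \<alpha>\<close> are disjoint for different \<open>\<alpha>\<close>, and an arc determines its
  activity, so the duration is a function of the arc.
\<close>

fun duration :: "nat \<Rightarrow> ('v activity \<Rightarrow> int) \<Rightarrow> 'v xarc \<Rightarrow> int" where
  "duration T l ((v, t), (w, t')) = (int t' - int t - l (v, w)) mod int T + l (v, w)"

definition vehicle_arcs ::
    "'v list set \<Rightarrow> nat \<Rightarrow> ('v activity \<Rightarrow> int) \<Rightarrow> ('v activity \<Rightarrow> int) \<Rightarrow> 'v xarc set" where
  "vehicle_arcs LL T l u = (\<Union>\<alpha>\<in>vehicle_activities LL. expanded_arcs T l u \<alpha>)"

definition transfer_arcs ::
    "'v list set \<Rightarrow> nat \<Rightarrow> ('v activity \<Rightarrow> int) \<Rightarrow> ('v activity \<Rightarrow> int) \<Rightarrow> 'v xarc set" where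
  "transfer_arcs LL T l u = (\<Union>\<alpha>\<in>transfer_activities LL. expanded_arcs T l u \<alpha>)"

definition expanded_network ::
    "'v list set \<Rightarrow> nat \<Rightarrow> ('v activity \<Rightarrow> int) \<Rightarrow> ('v activity \<Rightarrow> int) \<Rightarrow> 'v xnode pair_pre_digraph"
  where
  "expanded_network LL T l u = \<lparr> pverts = events LL \<times> {..<T},
     parcs = (\<Union>\<alpha>\<in>activities LL. expanded_arcs T l u \<alpha>) \<rparr>"

definition arcs_from :: "('a \<times> 'a) set \<Rightarrow> 'a \<Rightarrow> ('a \<times> 'a) set" where
  "arcs_from S v = {a \<in> S. fst a = v}"

definition arcs_into :: "('a \<times> 'a) set \<Rightarrow> 'a \<Rightarrow> ('a \<times> 'a) set" where
  "arcs_into S v = {a \<in> S. snd a = v}"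

definition expanded_line_cycle ::
    "'v list set \<Rightarrow> nat \<Rightarrow> ('v activity \<Rightarrow> int) \<Rightarrow> ('v activity \<Rightarrow> int) \<Rightarrow> 'v list
      \<Rightarrow> ('v xnode, 'v xarc) pre_digraph" where
  "expanded_line_cycle LL T l u L =
     with_proj (expanded_network LL T l u) \<restriction> (line_events L \<times> {..<T})"

text \<open>
  A cycle is represented by its set of arcs, so that rotations of the same closed path are
  identified; every node of a cycle is the tail of one of its arcs.
\<close>

definition cycle_nodes :: "('a \<times> 'a) set \<Rightarrow> 'a set" where
  "cycle_nodes c = fst ` c"

definition cycles_of_line ::
    "'v list set \<Rightarrow> nat \<Rightarrow> ('v activity \<Rightarrow> int) \<Rightarrow> ('v activity \<Rightarrow> int) \<Rightarrow> 'v list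
      \<Rightarrow> 'v xarc set set" where
  "cycles_of_line LL T l u L =
     {set c | c. pre_digraph.cycle (expanded_line_cycle LL T l u L) c \<and>
                 card (cycle_nodes (set c)) = card (line_events L)}"

definition cycles ::
    "'v list set \<Rightarrow> nat \<Rightarrow> ('v activity \<Rightarrow> int) \<Rightarrow> ('v activity \<Rightarrow> int) \<Rightarrow> 'v xarc set set" where
  "cycles LL T l u = (\<Union>L\<in>LL. cycles_of_line LL T l u L)"


section \<open>Polyhedra and maps\<close>

text \<open>
  Vectors indexed by a finite set are total functions; their values outside the index set occur
  neither in the constraints nor in the maps.
\<close>

definition tension ::
    "nat \<Rightarrow> ('v event \<Rightarrow> rat) \<Rightarrow> ('v activity \<Rightarrow> rat) \<Rightarrow> 'v activity \<Rightarrow> rat" where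
  "tension T \<pi> p \<alpha> = \<pi> (snd \<alpha>) - \<pi> (fst \<alpha>) + of_nat T * p \<alpha>"

definition P_PESP ::
    "'v list set \<Rightarrow> nat \<Rightarrow> ('v activity \<Rightarrow> int) \<Rightarrow> ('v activity \<Rightarrow> int)
      \<Rightarrow> (('v event \<Rightarrow> rat) \<times> ('v activity \<Rightarrow> rat)) set" where
  "P_PESP LL T l u = {(\<pi>, p).
     (\<forall>(v, w)\<in>activities LL.
        of_int (l (v, w)) \<le> \<pi> w - \<pi> v + of_nat T * p (v, w) \<and>
        \<pi> w - \<pi> v + of_nat T * p (v, w) \<le> of_int (u (v, w))) \<and>
     (\<forall>v\<in>events LL. 0 \<le> \<pi> v \<and> \<pi> v \<le> of_nat T - 1)}"

definition P_cXPESP ::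
    "'v list set \<Rightarrow> nat \<Rightarrow> ('v activity \<Rightarrow> int) \<Rightarrow> ('v activity \<Rightarrow> int)
      \<Rightarrow> (('v xarc set \<Rightarrow> rat) \<times> ('v xarc \<Rightarrow> rat)) set" where
  "P_cXPESP LL T l u = {(x, z).
     (\<forall>c\<in>cycles LL T l u. 0 \<le> x c) \<and>
     (\<forall>a\<in>transfer_arcs LL T l u. 0 \<le> z a) \<and>
     (\<forall>L\<in>LL. (\<Sum>c\<in>cycles_of_line LL T l u L. x c) = 1) \<and>
     (\<forall>(v, w)\<in>transfer_activities LL. \<forall>t<T.
        (\<Sum>c | c \<in> cycles LL T l u \<and> (v, t) \<in> cycle_nodes c. x c)
          = (\<Sum>a\<in>arcs_from (expanded_arcs T l u (v, w)) (v, t). z a) \<and>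
        (\<Sum>c | c \<in> cycles LL T l u \<and> (w, t) \<in> cycle_nodes c. x c)
          = (\<Sum>a\<in>arcs_into (expanded_arcs T l u (v, w)) (w, t). z a))}"

definition phi ::
    "'v list set \<Rightarrow> nat \<Rightarrow> ('v activity \<Rightarrow> int) \<Rightarrow> ('v activity \<Rightarrow> int)
      \<Rightarrow> ('v xarc set \<Rightarrow> rat) \<times> ('v xarc \<Rightarrow> rat) \<Rightarrow> ('v xarc \<Rightarrow> rat) \<times> ('v xarc \<Rightarrow> rat)" where
  "phi LL T l u = (\<lambda>(x, z). (\<lambda>a. \<Sum>c | c \<in> cycles LL T l u \<and> a \<in> c. x c, z))"

definition psi ::
    "'v list set \<Rightarrow> nat \<Rightarrow> ('v activity \<Rightarrow> int) \<Rightarrow> ('v activity \<Rightarrow> int)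
      \<Rightarrow> ('v xarc \<Rightarrow> rat) \<times> ('v xarc \<Rightarrow> rat) \<Rightarrow> ('v event \<Rightarrow> rat) \<times> ('v activity \<Rightarrow> rat)" where
  "psi LL T l u = (\<lambda>(x, z).
     (\<lambda>v. \<Sum>t<T. \<Sum>a\<in>arcs_from (vehicle_arcs LL T l u) (v, t). of_nat t * x a,
      \<lambda>\<alpha>. \<Sum>a\<in>expanded_arcs T l u \<alpha>.
        (of_int (duration T l a) - (of_nat (snd (snd a)) - of_nat (snd (fst a)))) / of_nat T *
        (if a \<in> vehicle_arcs LL T l u then x a else z a)))"

end

theory Submission
  imports Defs "HOL-Number_Theory.Cong"
begin

text \<open>
  A cycle of a line \<open>L\<close> projects to a closed walk with as many arcs as the line cycle has events, hence
  to exactly one tour of it: the cycle assigns one time \<open>\<theta> v\<close> to every event \<open>v\<close> of \<open>L\<close>. Its arc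
  durations therefore form an integral tension within the bounds \<open>l\<close> and \<open>u\<close> whose sum around
  the line cycle is a multiple of \<open>T\<close>. On the line cycle, the tension of \<open>\<psi>(\<phi>(x, z))\<close> is the
  convex combination of these integral tensions with weights \<open>x c\<close>, and each of the three
  inequalities, being affine, only has to be checked for an integral tension. The change-cycle
  inequality is the flip-cycle inequality with \<open>F = {}\<close>.
\<close>

section \<open>Timed arcs and closed walks over a cyclic event set\<close>

abbreviation underlying :: "'v xarc \<Rightarrow> 'v activity" where
  "underlying a \<equiv> (fst (fst a), fst (snd a))"

definition timed_arc :: "('v event \<Rightarrow> nat) \<Rightarrow> 'v activity \<Rightarrow> 'v xarc" where
  "timed_arc \<theta> \<alpha> = ((fst \<alpha>, \<theta> (fst \<alpha>)), (snd \<alpha>, \<theta> (snd \<alpha>)))"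

lemma underlying_timed_arc [simp]: "underlying (timed_arc \<theta> \<alpha>) = \<alpha>"
  by (simp add: timed_arc_def)

text \<open>The tails followed by the end node and the start node followed by the heads are the same
  list of nodes; on a closed walk the common endpoint cancels.\<close>

lemma pcas_closed_nodes:
  assumes "pcas u p u"
  shows "fst ` set p = snd ` set p"
proof -
  have "map fst p @ [v] = w # map snd p" if "pcas w p v" for v w
    using that by (induction p arbitrary: w) auto
  from this[OF assms] have "mset (map fst p) = mset (map snd p)"
    by (metis add_mset_add_single mset.simps(2) mset_append add_right_imp_eq union_commute mset.simps(1))
  then show ?thesis by (metis list.set_map mset_eq_setD)
qed

text \<open>The vertex list of a walk is its start followed by its heads, so the simplicity
  condition of a cycle is a condition on the heads.\<close>

lemma pcas_distinct_heads:
  assumes "pcas u p v" "distinct (tl (pawalk_verts u p))"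
  shows "distinct (map snd p)"
proof -
  have "pawalk_verts w p = w # map snd p" if "pcas w p v" for w
    using that by (induction p arbitrary: w) auto
  from this[OF assms(1)] assms(2) show ?thesis by simp
qed

lemma pcas_position:
  assumes "pcas u p v" "i < length p"
    and "\<And>a. a \<in> set p \<Longrightarrow> [pos (snd a) = pos (fst a) + 1] (mod N)"
  shows "[pos (fst (p ! i)) = pos u + int i] (mod N)"
  using assms
proof (induction p arbitrary: u i)
  case Nil
  then show ?case by simp
next
  case (Cons a p)
  show ?case
  proof (cases i)
    case 0
    then show ?thesis using Cons.prems by simp
  next
    case (Suc j)
    have "[pos (fst (p ! j)) = pos (snd a) + int j] (mod N)"
      using Cons.prems Suc by (intro Cons.IH) auto
    also have "[pos (snd a) + int j = pos u + 1 + int j] (mod N)"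
      using Cons.prems(1) Cons.prems(3)[of a] by (intro cong_add) auto
    finally show ?thesis using Suc by (simp add: add_ac)
  qed
qed

text \<open>
  A walk advances the position modulo \<open>N\<close> by one in each step, so a walk of length
  \<open>card V \<le> N\<close> visits pairwise different events, hence every event exactly once.
\<close>

lemma closed_walk_timing:
  fixes E :: "'v activity set" and p :: "'v xarc list"
  assumes E: "E \<subseteq> V \<times> V" and fin: "finite V" and N: "int (card V) \<le> N"
    and step: "\<And>\<alpha>. \<alpha> \<in> E \<Longrightarrow> [pos (snd \<alpha>) = pos (fst \<alpha>) + 1] (mod N)"
    and walk: "pcas u p u" "distinct (map snd p)" and len: "card (fst ` set p) = card V"
    and arcs: "\<And>a. a \<in> set p \<Longrightarrow> underlying a \<in> E"
  shows "\<exists>\<theta>. set p = timed_arc \<theta> ` E" "bij_betw fst E V" "bij_betw snd E V"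
proof -
  have nodes: "fst ` set p = snd ` set p"
    by (rule pcas_closed_nodes) (rule walk)
  \<comment> \<open>Distinctness is given for the heads, the cardinality for the tails; closedness
    identifies the two node sets.\<close>
  have "length p = card (set (map snd p))"
    using walk(2) by (metis distinct_card length_map)
  with nodes len have len_p: "length p = card V" by simp
  have pos: "[pos (fst (fst (p ! i))) = pos (fst u) + int i] (mod N)" if "i < length p" for i
    using pcas_position[OF walk(1) that, of "pos \<circ> fst" N] step arcs by force
  have eqI: "i = j" if "i < length p" "j < length p"
    "[pos (fst (fst (p ! i))) = pos (fst (fst (p ! j)))] (mod N)" for i j
  proof -
    have "[pos (fst u) + int i = pos (fst u) + int j] (mod N)"
      using pos[OF that(1)] pos[OF that(2)] that(3) cong_sym cong_trans by blast
    \<comment> \<open>Both indices lie below \<open>card V \<le> N\<close>, so congruence forces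
      equality.\<close>
    then have "[int i = int j] (mod N)" by (simp add: cong_add_lcancel)
    then show ?thesis using that(1,2) len_p N by (simp add: cong_def)
  qed
  define ev where "ev = (\<lambda>a :: 'v xarc. fst (fst a))"
  have inj_ev: "inj_on ev (set p)"
    by (rule inj_onI) (metis eqI in_set_conv_nth cong_refl ev_def)
  have "distinct p" using walk(2) distinct_map by blast
  then have "card (ev ` set p) = card V"
    using inj_ev len_p by (simp add: card_image distinct_card)
  moreover have "ev ` set p \<subseteq> V" using arcs E by (force simp: ev_def)
  ultimately have ev_V: "ev ` set p = V" using fin by (simp add: card_subset_eq)
  \<comment> \<open>All of \<open>V\<close> occurs on the walk, so positions modulo \<open>N\<close>
    separate its events. As an activity shifts the position by one, each of its endpoints determines
    the other.\<close>
  have inj_pos: "v = w" if "v \<in> V" "w \<in> V" "[pos v = pos w] (mod N)" for v w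
  proof -
    from that(1,2) ev_V obtain i j where "i < length p" "v = ev (p ! i)" "j < length p" "w = ev (p ! j)"
      by (metis (no_types, lifting) imageE in_set_conv_nth)
    with eqI that(3) show ?thesis by (metis ev_def)
  qed
  have inj_fst: "inj_on fst E"
  proof (rule inj_onI)
    fix \<alpha> \<beta> assume *: "\<alpha> \<in> E" "\<beta> \<in> E" "fst \<alpha> = fst \<beta>"
    then have "[pos (snd \<alpha>) = pos (snd \<beta>)] (mod N)"
      using step[of \<alpha>] step[of \<beta>] by (simp add: cong_def)
    with * E have "snd \<alpha> = snd \<beta>" by (intro inj_pos) auto
    with * show "\<alpha> = \<beta>" by (metis prod.collapse)
  qed
  have inj_snd: "inj_on snd E"
  proof (rule inj_onI)
    fix \<alpha> \<beta> assume *: "\<alpha> \<in> E" "\<beta> \<in> E" "snd \<alpha> = snd \<beta>"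
    then have "[pos (fst \<alpha>) + 1 = pos (fst \<beta>) + 1] (mod N)"
      using step[of \<alpha>] step[of \<beta>] by (simp add: cong_def)
    then have "[pos (fst \<alpha>) = pos (fst \<beta>)] (mod N)" by (simp add: cong_add_rcancel)
    with * E have "fst \<alpha> = fst \<beta>" by (intro inj_pos) auto
    with * show "\<alpha> = \<beta>" by (metis prod.collapse)
  qed
  have ev_arc: "ev a \<in> fst ` E" "fst (snd a) \<in> snd ` E" if "a \<in> set p" for a
    using imageI[OF arcs[OF that], of fst] imageI[OF arcs[OF that], of snd]
    by (simp_all add: ev_def)
  have "V \<subseteq> fst ` E" using ev_arc(1) unfolding ev_V[symmetric] by blast
  moreover have "fst ` E \<subseteq> V" "snd ` E \<subseteq> V" using E by auto
  moreover have "fst ` snd ` set p = V"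
    using ev_V unfolding nodes[symmetric] image_image ev_def .
  then have "V \<subseteq> snd ` E" using ev_arc(2) by blast
  ultimately show "bij_betw fst E V" "bij_betw snd E V"
    using inj_fst inj_snd by (simp_all only: bij_betw_def subset_antisym simp_thms)
  \<comment> \<open>The time of \<open>v\<close> is read off the only arc of the walk that leaves
    \<open>v\<close>.\<close>
  define \<theta> where "\<theta> v = snd (fst (inv_into (set p) ev v))" for v
  have tail: "\<theta> (fst (fst a)) = snd (fst a)" if "a \<in> set p" for a
    using inv_into_f_f[OF inj_ev that] by (simp add: \<theta>_def ev_def)
  have head: "\<theta> (fst (snd a)) = snd (snd a)" if a: "a \<in> set p" for a
  proof -
    \<comment> \<open>The head of an arc is, together with its time, the tail of another arc of the
      closed walk; hence arriving and leaving times agree.\<close>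
    have "snd a \<in> fst ` set p" using a unfolding nodes by (rule imageI)
    then obtain b where "b \<in> set p" "snd a = fst b" by (rule imageE) simp
    with tail[of b] show ?thesis by simp
  qed
  have timed: "timed_arc \<theta> (underlying a) = a" if "a \<in> set p" for a
    using tail[OF that] head[OF that] by (simp add: timed_arc_def prod_eq_iff)
  \<comment> \<open>Every activity is traversed: the arc leaving the event
    \<open>fst \<alpha>\<close> lies over an activity with the same start, which is
    \<open>\<alpha>\<close> by injectivity.\<close>
  have "timed_arc \<theta> \<alpha> \<in> set p" if \<alpha>: "\<alpha> \<in> E" for \<alpha>
  proof -
    have "fst \<alpha> \<in> ev ` set p" using \<alpha> E unfolding ev_V by auto
    then obtain a where a: "a \<in> set p" "fst \<alpha> = ev a" by (rule imageE) simp
    have "underlying a = \<alpha>"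
      by (rule inj_onD[OF inj_fst _ arcs[OF a(1)] \<alpha>]) (simp add: a(2) ev_def)
    with timed[OF a(1)] a(1) show ?thesis by simp
  qed
  moreover have "a \<in> timed_arc \<theta> ` E" if "a \<in> set p" for a
    using imageI[OF arcs[OF that], of "timed_arc \<theta>"] unfolding timed[OF that] .
  ultimately have "set p = timed_arc \<theta> ` E" by (intro equalityI subsetI) auto
  then show "\<exists>\<theta>. set p = timed_arc \<theta> ` E" by blast
qed

section \<open>Positions of events along a line cycle\<close>

definition stop_index :: "'v list \<Rightarrow> 'v \<Rightarrow> int" where
  "stop_index L v = int (inv_into {..<length L} ((!) L) v)"

text \<open>
  The line cycle runs from \<open>Dep\<close> at the first stop forward to the last stop, which it leaves at
  position \<open>2 * (length L - 1)\<close>, and back; modulo \<open>4 * (length L - 1)\<close> the return trip is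
  numbered by the negative integers.
\<close>

fun position :: "'v event \<Rightarrow> int" where
  "position (v, L, Dep, Fwd) = 2 * stop_index L v"
| "position (v, L, Arr, Fwd) = 2 * stop_index L v - 1"
| "position (v, L, Dep, Bwd) = - 2 * stop_index L v"
| "position (v, L, Arr, Bwd) = - 2 * stop_index L v - 1"

lemma stop_index_nth: "distinct L \<Longrightarrow> i < length L \<Longrightarrow> stop_index L (L ! i) = int i"
  unfolding stop_index_def by (subst inv_into_f_f) (auto simp: inj_on_def nth_eq_iff_index_eq)

lemma position_step:
  assumes L: "distinct L" "1 < length L" and \<alpha>: "\<alpha> \<in> line_activities L"
  shows "[position (snd \<alpha>) = position (fst \<alpha>) + 1] (mod 4 * (int (length L) - 1))"
proof -
  consider "\<alpha> \<in> driving L" | "\<alpha> \<in> waiting L" | "\<alpha> \<in> turnaround L"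
    using \<alpha> by (auto simp: line_activities_def)
  then show ?thesis
  proof cases
    case 1
    then show ?thesis by (auto simp: driving_def stop_index_nth[OF L(1)] cong_iff_dvd_diff)
  next
    case 2
    then obtain v s where "\<alpha> = ((v, L, Arr, s), (v, L, Dep, s))" by (auto simp: waiting_def)
    then show ?thesis by (cases s) auto
  next
    case 3
    have "L \<noteq> []" using L by auto
    then have "stop_index L (hd L) = 0" "stop_index L (last L) = int (length L) - 1"
      using L by (auto simp: hd_conv_nth last_conv_nth stop_index_nth of_nat_diff)
    \<comment> \<open>This is for the turnaround at the last stop, the only activity that wraps
      around: with \<open>k\<close> stops it leads from position \<open>2 * k - 3\<close> to
      \<open>2 - 2 * k\<close>.\<close>
    moreover have "4 * k - 4 dvd 4 - 4 * k" for k :: int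
      by (rule dvdI[of _ _ "- 1"]) simp
    ultimately show ?thesis using 3 by (auto simp: turnaround_def cong_iff_dvd_diff)
  qed
qed

lemma finite_line_events: "finite (line_events L)"
proof -
  have "finite {i. Suc i < length L}" by (rule finite_subset[of _ "{..<length L}"]) auto
  then show ?thesis by (simp add: line_events_def)
qed

text \<open>Each edge contributes at most four events. The bound is the modulus of
  \<open>position_step\<close>, as \<open>closed_walk_timing\<close> requires.\<close>

lemma card_line_events: "card (line_events L) \<le> 4 * (length L - 1)"
proof -
  have I: "{i. Suc i < length L} = {..<length L - 1}" by auto
  have "card (line_events L) \<le> (\<Sum>i<length L - 1. 4)"
    unfolding line_events_def I
    by (rule order_trans[OF card_UN_le]) (auto intro!: sum_mono card_insert_le_m1)
  then show ?thesis by simp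
qed

lemma line_of_event: "v \<in> line_events L \<Longrightarrow> fst (snd v) = L"
  by (auto simp: line_events_def)

lemma line_activities_events:
  assumes "1 < length L"
  shows "line_activities L \<subseteq> line_events L \<times> line_events L"
proof -
  have "L \<noteq> []" using assms by auto
  \<comment> \<open>Both ends are written as endpoints of an edge; \<open>length L - 2\<close> is
    the index of the last edge.\<close>
  then have ends: "hd L = L ! 0" "last L = L ! Suc (length L - 2)"
    using assms by (auto simp: hd_conv_nth last_conv_nth Suc_diff_Suc numeral_2_eq_2)
  have "0 \<in> {i. Suc i < length L}" "length L - 2 \<in> {i. Suc i < length L}" using assms by auto
  then have "turnaround L \<subseteq> line_events L \<times> line_events L"
    unfolding turnaround_def line_events_def ends by blast
  moreover have "driving L \<subseteq> line_events L \<times> line_events L"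
    by (auto simp: driving_def line_events_def)
  moreover have "waiting L \<subseteq> line_events L \<times> line_events L"
    by (auto simp: waiting_def)
  ultimately show ?thesis by (auto simp: line_activities_def)
qed

section \<open>Cycles of a line and their arc durations\<close>

lemma underlying_expanded_arcs: "a \<in> expanded_arcs T l u \<alpha> \<Longrightarrow> underlying a = \<alpha>"
  by (auto simp: expanded_arcs_def)

lemma finite_expanded_arcs: "finite (expanded_arcs T l u \<alpha>)"
  by (rule finite_subset[of _ "(\<lambda>(t, t'). ((fst \<alpha>, t), (snd \<alpha>, t'))) ` ({..<T} \<times> {..<T})"])
    (auto simp: expanded_arcs_def)

lemma finite_line_activities:
  "1 < length L \<Longrightarrow> finite (line_activities L)"
  by (metis finite_SigmaI finite_line_events finite_subset line_activities_events)

lemma line_of_activity: "\<alpha> \<in> line_activities L \<Longrightarrow> fst (snd (fst \<alpha>)) = L"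
  by (auto simp: line_activities_def driving_def waiting_def turnaround_def)

text \<open>Events record their line: a transfer joins two different lines, and a vehicle activity
  of another line starts at an event of that line.\<close>

lemma activity_within_line:
  assumes "\<alpha> \<in> activities LL" "fst \<alpha> \<in> line_events L" "snd \<alpha> \<in> line_events L"
  shows "\<alpha> \<in> line_activities L"
proof -
  have "fst (snd (fst \<alpha>)) = L" "fst (snd (snd \<alpha>)) = L"
    using assms(2,3) by (simp_all add: line_of_event)
  then show ?thesis
    using assms(1) line_of_activity
    by (fastforce simp: network_def vehicle_activities_def transfer_activities_def)
qed

text \<open>This is \<open>closed_walk_timing\<close> for the projection of \<open>c\<close> to the
  line cycle. The two bijections concern the line alone, but are derived from the existence of a
  cycle.\<close>

lemma cycles_of_line_structure:
  assumes L: "distinct L" "1 < length L" and c: "c \<in> cycles_of_line LL T l u L"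
  shows "\<exists>\<theta>. c = timed_arc \<theta> ` line_activities L"
    and "bij_betw fst (line_activities L) (line_events L)"
    and "bij_betw snd (line_activities L) (line_events L)"
    and "c \<subseteq> (\<Union>\<alpha>\<in>line_activities L. expanded_arcs T l u \<alpha>)"
proof -
  let ?D = "expanded_line_cycle LL T l u L"
  obtain p where p: "pre_digraph.cycle ?D p" "c = set p" "card (fst ` set p) = card (line_events L)"
    using c by (auto simp: cycles_of_line_def cycle_nodes_def)
  \<comment> \<open>In this form the general walk notions on the induced subgraph become those for
    pair digraphs.\<close>
  have "?D = with_proj \<lparr>pverts = verts ?D, parcs = arcs ?D\<rparr>"
    by (simp add: expanded_line_cycle_def induce_subgraph_def with_proj_def)
  then have cas: "pre_digraph.cas ?D = pcas" and verts: "pre_digraph.awalk_verts ?D = pawalk_verts"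
    using cas_with_proj_eq awalk_verts_with_proj_eq by metis+
  obtain w where w: "pcas w p w" "distinct (tl (pawalk_verts w p))" "set p \<subseteq> arcs ?D"
    using p(1) by (auto simp: pre_digraph.cycle_def pre_digraph.awalk_def cas verts)
  have arcs: "underlying a \<in> line_activities L \<and> a \<in> expanded_arcs T l u (underlying a)"
    if a: "a \<in> set p" for a
  proof -
    obtain \<alpha> where \<alpha>: "\<alpha> \<in> activities LL" "a \<in> expanded_arcs T l u \<alpha>"
      "fst (fst a) \<in> line_events L" "fst (snd a) \<in> line_events L"
      using a w(3) by (auto simp: expanded_line_cycle_def expanded_network_def)
    with underlying_expanded_arcs[OF \<alpha>(2)] activity_within_line[OF \<alpha>(1), of L] show ?thesis by auto
  qed
  then show "c \<subseteq> (\<Union>\<alpha>\<in>line_activities L. expanded_arcs T l u \<alpha>)" using p(2) by blast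
  have "int (card (line_events L)) \<le> 4 * (int (length L) - 1)"
    using card_line_events[of L] L(2) by (cases "length L") auto
  note timing = closed_walk_timing[OF line_activities_events[OF L(2)] finite_line_events this
      position_step[OF L] w(1) pcas_distinct_heads[OF w(1,2)] p(3)]
  show "\<exists>\<theta>. c = timed_arc \<theta> ` line_activities L"
    "bij_betw fst (line_activities L) (line_events L)"
    "bij_betw snd (line_activities L) (line_events L)"
    using timing arcs p(2) by auto
qed

lemma duration_timed_arc:
  "duration T l (timed_arc \<theta> \<alpha>)
     = (int (\<theta> (snd \<alpha>)) - int (\<theta> (fst \<alpha>)) - l \<alpha>) mod int T + l \<alpha>"
  by (simp add: timed_arc_def)

text \<open>A duration differs from the time difference of its endpoints by a multiple of
  \<open>T\<close>. The time differences cancel in the sum, since every event is the start of one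
  activity and the end of one.\<close>

lemma period_dvd_duration:
  assumes "bij_betw fst E V" "bij_betw snd E V"
  shows "int T dvd (\<Sum>\<alpha>\<in>E. duration T l (timed_arc \<theta> \<alpha>))"
proof -
  have "(\<Sum>\<alpha>\<in>E. int (\<theta> (snd \<alpha>))) = (\<Sum>\<alpha>\<in>E. int (\<theta> (fst \<alpha>)))"
    using sum.reindex_bij_betw[OF assms(1), of "\<lambda>v. int (\<theta> v)"]
      sum.reindex_bij_betw[OF assms(2), of "\<lambda>v. int (\<theta> v)"] by simp
  then have "(\<Sum>\<alpha>\<in>E. duration T l (timed_arc \<theta> \<alpha>))
    = (\<Sum>\<alpha>\<in>E. duration T l (timed_arc \<theta> \<alpha>) - (int (\<theta> (snd \<alpha>)) - int (\<theta> (fst \<alpha>))))"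
    by (simp add: sum_subtractf)
  moreover have "int T dvd duration T l (timed_arc \<theta> \<alpha>) - (int (\<theta> (snd \<alpha>)) - int (\<theta> (fst \<alpha>)))" for \<alpha>
    unfolding duration_timed_arc
    using mod_eq_dvd_iff[of "(int (\<theta> (snd \<alpha>)) - int (\<theta> (fst \<alpha>)) - l \<alpha>) mod int T" "int T"
        "int (\<theta> (snd \<alpha>)) - int (\<theta> (fst \<alpha>)) - l \<alpha>"] by (simp add: algebra_simps)
  ultimately show ?thesis by (metis (no_types, lifting) dvd_sum)
qed

section \<open>Finiteness, and the tension as a weighted sum over cycles\<close>

lemma finite_vehicle_arcs:
  assumes "finite LL" "\<And>L. L \<in> LL \<Longrightarrow> 1 < length L"
  shows "finite (vehicle_arcs LL T l u)"
  unfolding vehicle_arcs_def vehicle_activities_def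
  using assms by (intro finite_UN_I finite_line_activities finite_expanded_arcs) auto

lemma finite_activities:
  assumes "finite LL" "\<And>L. L \<in> LL \<Longrightarrow> 1 < length L"
  shows "finite (activities LL)"
proof -
  have "finite (vehicle_activities LL)"
    using assms finite_line_activities by (auto simp: vehicle_activities_def)
  moreover have "transfer_activities LL \<subseteq> (\<Union>(line_events ` LL)) \<times> (\<Union>(line_events ` LL))"
    by (auto simp: transfer_activities_def)
  then have "finite (transfer_activities LL)"
    by (rule finite_subset) (use assms(1) finite_line_events in auto)
  ultimately show ?thesis by (simp add: network_def)
qed

lemma line_activities_vehicle_arcs:
  "L \<in> LL \<Longrightarrow> (\<Union>\<alpha>\<in>line_activities L. expanded_arcs T l u \<alpha>) \<subseteq> vehicle_arcs LL T l u"
  by (auto simp: vehicle_arcs_def vehicle_activities_def)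

lemma finite_cycles:
  assumes "finite LL" "\<And>L. L \<in> LL \<Longrightarrow> distinct L \<and> 1 < length L"
  shows "finite (cycles LL T l u)"
proof (rule finite_subset)
  show "cycles LL T l u \<subseteq> Pow (vehicle_arcs LL T l u)"
    unfolding cycles_def
    using cycles_of_line_structure(4) line_activities_vehicle_arcs assms(2) by fast
  show "finite (Pow (vehicle_arcs LL T l u))"
    using finite_vehicle_arcs assms by blast
qed

text \<open>Exchange of the sums over arcs and cycles: cycles of other lines miss \<open>W\<close>,
  and each cycle of \<open>L\<close> meets it in one arc. It serves both the potentials, with all
  arcs leaving an event, and the offsets \<open>p\<close>, with all arcs over an activity.\<close>

lemma sum_phi_line:
  assumes LL: "finite LL" "\<And>L. L \<in> LL \<Longrightarrow> distinct L \<and> 1 < length L" and L: "L \<in> LL"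
    and W: "finite W" "\<And>a. a \<in> W \<Longrightarrow> fst (snd (fst (fst a))) = L"
    and f: "\<And>c. c \<in> cycles_of_line LL T l u L \<Longrightarrow> W \<inter> c = {f c}"
  shows "(\<Sum>a\<in>W. g a * fst (phi LL T l u (x, z)) a)
    = (\<Sum>c\<in>cycles_of_line LL T l u L. x c * g (f c))"
proof -
  let ?C = "cycles LL T l u"
  have fin: "finite ?C" by (rule finite_cycles[OF LL])
  have "(\<Sum>a\<in>W. g a * fst (phi LL T l u (x, z)) a)
      = (\<Sum>a\<in>W. \<Sum>c\<in>?C. if a \<in> c then x c * g a else 0)"
    using fin by (simp add: phi_def sum_distrib_left mult.commute sum.If_cases Int_def flip: sum.inter_filter)
  also have "\<dots> = (\<Sum>c\<in>?C. \<Sum>a\<in>W. if a \<in> c then x c * g a else 0)"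
    by (rule sum.swap)
  also have "\<dots> = (\<Sum>c\<in>?C. x c * (\<Sum>a\<in>W \<inter> c. g a))"
    using W(1) by (simp add: sum_distrib_left flip: sum.inter_restrict)
  also have "\<dots> = (\<Sum>c\<in>cycles_of_line LL T l u L. x c * (\<Sum>a\<in>W \<inter> c. g a))"
  proof (rule sum.mono_neutral_right[OF fin])
    show "cycles_of_line LL T l u L \<subseteq> ?C" using L by (auto simp: cycles_def)
    show "\<forall>c\<in>?C - cycles_of_line LL T l u L. x c * (\<Sum>a\<in>W \<inter> c. g a) = 0"
    proof
      fix c assume "c \<in> ?C - cycles_of_line LL T l u L"
      then obtain L' where L': "L' \<in> LL" "c \<in> cycles_of_line LL T l u L'" "L' \<noteq> L"
        by (auto simp: cycles_def)
      have "fst (snd (fst (fst a))) = L'" if a: "a \<in> c" for a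
      proof -
        obtain \<alpha> where \<alpha>: "\<alpha> \<in> line_activities L'" "a \<in> expanded_arcs T l u \<alpha>"
          using cycles_of_line_structure(4)[OF _ _ L'(2)] LL(2)[OF L'(1)] a by blast
        show ?thesis
          using line_of_activity[OF \<alpha>(1)] by (simp flip: underlying_expanded_arcs[OF \<alpha>(2)])
      qed
      with W(2) L'(3) have "W \<inter> c = {}" by blast
      then show "x c * (\<Sum>a\<in>W \<inter> c. g a) = 0" by simp
    qed
  qed
  also have "\<dots> = (\<Sum>c\<in>cycles_of_line LL T l u L. x c * g (f c))"
    using f by simp
  finally show ?thesis .
qed

text \<open>With weights \<open>x c\<close>, \<open>\<pi> v\<close> sums the times of
  \<open>v\<close>, and \<open>of_nat T * p \<alpha>\<close> sums the durations minus the time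
  differences; in the tension the time differences cancel.\<close>

lemma tension_psi_phi:
  assumes LL: "finite LL" "\<And>L. L \<in> LL \<Longrightarrow> distinct L \<and> 1 < length L" and L: "L \<in> LL"
    and T: "T \<ge> 1"
    and \<Theta>: "\<And>c. c \<in> cycles_of_line LL T l u L \<Longrightarrow> timed_arc (\<Theta> c) ` line_activities L = c"
    and psi: "(\<pi>, p) = psi LL T l u (phi LL T l u (x, z))"
    and \<alpha>: "\<alpha> \<in> line_activities L"
  shows "tension T \<pi> p \<alpha>
    = (\<Sum>c\<in>cycles_of_line LL T l u L. x c * of_int (duration T l (timed_arc (\<Theta> c) \<alpha>)))"
proof -
  let ?C = "cycles_of_line LL T l u L" and ?VA = "vehicle_arcs LL T l u"
  define xb where "xb = fst (phi LL T l u (x, z))"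
  have phi: "phi LL T l u (x, z) = (xb, z)" by (simp add: xb_def phi_def)
  have L': "distinct L" "1 < length L" using LL(2)[OF L] by auto
  have mem: "a \<in> c \<longleftrightarrow> a \<in> timed_arc (\<Theta> c) ` line_activities L" if "c \<in> ?C" for a c
    using arg_cong[OF \<Theta>[OF that], of "\<lambda>A. a \<in> A"] by (rule sym)
  have in_exp: "timed_arc (\<Theta> c) \<beta> \<in> expanded_arcs T l u \<beta>"
    if c: "c \<in> ?C" and \<beta>: "\<beta> \<in> line_activities L" for c \<beta>
  proof -
    have "timed_arc (\<Theta> c) \<beta> \<in> c" using c \<beta> by (simp add: mem)
    then obtain \<gamma> where "timed_arc (\<Theta> c) \<beta> \<in> expanded_arcs T l u \<gamma>"
      using cycles_of_line_structure(4)[OF L' c] by blast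
    with underlying_expanded_arcs[OF this] show ?thesis by simp
  qed
  have pot: "\<pi> v = (\<Sum>c\<in>?C. x c * of_nat (\<Theta> c v))" if v: "v \<in> line_events L" for v
  proof -
    \<comment> \<open>All arcs leaving \<open>v\<close>, at any time: a cycle of \<open>L\<close>
      visits \<open>v\<close> once and so uses exactly one of them.\<close>
    let ?W = "\<Union>t<T. arcs_from ?VA (v, t)"
    have fin: "finite (arcs_from ?VA w)" for w
      using finite_vehicle_arcs[of LL T l u] LL by (simp add: arcs_from_def)
    have "\<pi> v = (\<Sum>t<T. \<Sum>a\<in>arcs_from ?VA (v, t). of_nat t * xb a)"
      using psi by (simp add: phi psi_def)
    also have "\<dots> = (\<Sum>t<T. \<Sum>a\<in>arcs_from ?VA (v, t). of_nat (snd (fst a)) * xb a)"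
      by (intro sum.cong) (auto simp: arcs_from_def)
    also have "\<dots> = (\<Sum>a\<in>?W. of_nat (snd (fst a)) * xb a)"
      using fin by (intro sum.UNION_disjoint[symmetric]) (auto simp: arcs_from_def)
    also have "\<dots> = (\<Sum>c\<in>?C. x c * of_nat (\<Theta> c v))"
    \<comment> \<open>The bijection is available only if a cycle exists; otherwise both sides are
      zero.\<close>
    proof (cases "?C = {}")
      case True
      then show ?thesis
        unfolding xb_def using fin line_of_event[OF v]
        by (subst sum_phi_line[OF LL L, of ?W]) (auto simp: arcs_from_def)
    next
      case False
      then have bij: "bij_betw fst (line_activities L) (line_events L)"
        using cycles_of_line_structure(2)[OF L'] by blast
      then obtain \<beta> where \<beta>: "\<beta> \<in> line_activities L" "fst \<beta> = v"
        using v by (metis bij_betw_imp_surj_on imageE)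
      have "?W \<inter> c = {timed_arc (\<Theta> c) \<beta>}" if c: "c \<in> ?C" for c
      proof
        have "timed_arc (\<Theta> c) \<beta> \<in> c" using mem[OF c] \<beta> by blast
        moreover have "timed_arc (\<Theta> c) \<beta> \<in> ?VA"
          using in_exp[OF c \<beta>(1)] line_activities_vehicle_arcs[OF L, of T l u] \<beta>(1) by blast
        moreover have "\<Theta> c v < T"
          using in_exp[OF c \<beta>(1)] \<beta>(2) by (auto simp: expanded_arcs_def timed_arc_def)
        ultimately show "{timed_arc (\<Theta> c) \<beta>} \<subseteq> ?W \<inter> c"
          using \<beta>(2) by (auto simp: arcs_from_def timed_arc_def)
        show "?W \<inter> c \<subseteq> {timed_arc (\<Theta> c) \<beta>}"
        proof
          fix a assume a: "a \<in> ?W \<inter> c"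
          then obtain \<gamma> where \<gamma>: "\<gamma> \<in> line_activities L" "a = timed_arc (\<Theta> c) \<gamma>"
            using mem[OF c] by blast
          with a have "fst \<gamma> = fst \<beta>" using \<beta> by (auto simp: arcs_from_def timed_arc_def)
          then have "\<gamma> = \<beta>" using bij \<gamma>(1) \<beta>(1) by (meson bij_betw_imp_inj_on inj_onD)
          with \<gamma> show "a \<in> {timed_arc (\<Theta> c) \<beta>}" by simp
        qed
      qed
      then show ?thesis
        unfolding xb_def using fin line_of_event[OF v] \<beta>(2)
        by (subst sum_phi_line[OF LL L, of ?W _ _ _ "\<lambda>c. timed_arc (\<Theta> c) \<beta>"])
          (auto simp: arcs_from_def timed_arc_def)
    qed
    finally show ?thesis .
  qed
  let ?g = "\<lambda>a. (of_int (duration T l a) - (of_nat (snd (snd a)) - of_nat (snd (fst a)))) / of_nat T :: rat"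
  have "p \<alpha> = (\<Sum>a\<in>expanded_arcs T l u \<alpha>. ?g a * (if a \<in> ?VA then xb a else z a))"
    using psi by (simp add: phi psi_def)
  \<comment> \<open>Since \<open>\<alpha>\<close> belongs to a line, all arcs over it are vehicle
    arcs.\<close>
  also have "\<dots> = (\<Sum>a\<in>expanded_arcs T l u \<alpha>. ?g a * xb a)"
    using line_activities_vehicle_arcs[OF L, of T l u] \<alpha> by (intro sum.cong) auto
  also have "\<dots> = (\<Sum>c\<in>?C. x c * ?g (timed_arc (\<Theta> c) \<alpha>))"
    unfolding xb_def
  proof (rule sum_phi_line[OF LL L finite_expanded_arcs])
    show "fst (snd (fst (fst a))) = L" if "a \<in> expanded_arcs T l u \<alpha>" for a
      using underlying_expanded_arcs[OF that] line_of_activity[OF \<alpha>] by (metis fst_conv)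
    show "expanded_arcs T l u \<alpha> \<inter> c = {timed_arc (\<Theta> c) \<alpha>}" if c: "c \<in> ?C" for c
    proof
      show "{timed_arc (\<Theta> c) \<alpha>} \<subseteq> expanded_arcs T l u \<alpha> \<inter> c"
        using in_exp[OF c \<alpha>] mem[OF c] \<alpha> by blast
      show "expanded_arcs T l u \<alpha> \<inter> c \<subseteq> {timed_arc (\<Theta> c) \<alpha>}"
      proof
        fix a assume a: "a \<in> expanded_arcs T l u \<alpha> \<inter> c"
        then obtain \<gamma> where \<gamma>: "a = timed_arc (\<Theta> c) \<gamma>"
          using mem[OF c] by blast
        with a underlying_expanded_arcs[of a T l u \<alpha>] show "a \<in> {timed_arc (\<Theta> c) \<alpha>}" by simp
      qed
    qed
  qed
  finally have "of_nat T * p \<alpha> = (\<Sum>c\<in>?C. x c * (of_nat T * ?g (timed_arc (\<Theta> c) \<alpha>)))"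
    by (simp only: sum_distrib_left mult.left_commute)
  also have "\<dots> = (\<Sum>c\<in>?C. x c * (of_int (duration T l (timed_arc (\<Theta> c) \<alpha>))
      - (of_nat (\<Theta> c (snd \<alpha>)) - of_nat (\<Theta> c (fst \<alpha>)))))"
    using T by (simp add: timed_arc_def)
  finally have p: "of_nat T * p \<alpha> = \<dots>" .
  have "fst \<alpha> \<in> line_events L" "snd \<alpha> \<in> line_events L"
    using \<alpha> line_activities_events[OF L'(2)] by auto
  then show ?thesis
    by (simp add: tension_def pot p right_diff_distrib sum_subtractf)
qed

section \<open>The inequalities for integral tensions and their convex combinations\<close>

text \<open>
  With \<open>A\<close> and \<open>B\<close> the two slack sums, \<open>A - B\<close> is congruent to \<open>\<xi>\<close> modulo \<open>T\<close>;
  hence \<open>A \<ge> \<xi>\<close> or \<open>B \<ge> T - \<xi>\<close>.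
\<close>

lemma flip_inequality:
  fixes l u y :: "'a \<Rightarrow> int" and T :: int
  assumes E: "finite E" and T: "T \<ge> 1"
    and y: "\<And>a. a \<in> E \<Longrightarrow> l a \<le> y a \<and> y a \<le> u a" and dvd: "T dvd (\<Sum>a\<in>E. y a)"
    and \<xi>: "\<xi> = (- (\<Sum>a\<in>E - F. l a) - (\<Sum>a\<in>E \<inter> F. u a)) mod T"
  shows "(T - \<xi>) * (\<Sum>a\<in>E - F. y a - l a) + \<xi> * (\<Sum>a\<in>E \<inter> F. u a - y a) \<ge> \<xi> * (T - \<xi>)"
proof -
  let ?A = "\<Sum>a\<in>E - F. y a - l a" and ?B = "\<Sum>a\<in>E \<inter> F. u a - y a"
  let ?s = "- (\<Sum>a\<in>E - F. l a) - (\<Sum>a\<in>E \<inter> F. u a)"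
  have A: "?A \<ge> 0" and B: "?B \<ge> 0" using y by (auto intro!: sum_nonneg)
  have \<xi>_bounds: "0 \<le> \<xi>" "\<xi> < T" using T \<xi> by auto
  have "(\<Sum>a\<in>E. y a) = (\<Sum>a\<in>E - F. y a) + (\<Sum>a\<in>E \<inter> F. y a)"
    by (metis E add.commute sum.Int_Diff)
  then have "?A - ?B = (\<Sum>a\<in>E. y a) + ?s" by (simp add: sum_subtractf)
  moreover have "?s = \<xi> + T * (?s div T)" using \<xi> by (metis add.commute mult_div_mod_eq)
  moreover obtain k where "(\<Sum>a\<in>E. y a) = T * k" using dvd by blast
  ultimately have "?A - ?B = \<xi> + T * (k + ?s div T)" by (simp add: distrib_left)
  then obtain j where j: "?A - ?B = \<xi> + T * j" by blast
  show ?thesis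
  \<comment> \<open>The sign of \<open>j\<close> decides which slack sum is large; its term alone
    reaches \<open>\<xi> * (T - \<xi>)\<close>, and the other term is nonnegative.\<close>
  proof (cases "j \<ge> 0")
    case True
    then have "?A \<ge> \<xi>" using j B T by (smt (verit) mult_nonneg_nonneg)
    then have "(T - \<xi>) * ?A \<ge> (T - \<xi>) * \<xi>" using \<xi>_bounds by (intro mult_left_mono) auto
    moreover have "\<xi> * ?B \<ge> 0" using \<xi>_bounds B by simp
    ultimately show ?thesis by (simp add: mult.commute)
  next
    case False
    then have "T * j \<le> T * (- 1)" using T by (intro mult_left_mono) auto
    then have "?B \<ge> T - \<xi>" using j A by linarith
    then have "\<xi> * ?B \<ge> \<xi> * (T - \<xi>)" using \<xi>_bounds by (intro mult_left_mono) auto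
    moreover have "(T - \<xi>) * ?A \<ge> 0" using \<xi>_bounds A by simp
    ultimately show ?thesis by linarith
  qed
qed

lemma convex_combination_ge:
  fixes w f :: "'c \<Rightarrow> 'a :: linordered_idom"
  assumes "\<And>c. c \<in> C \<Longrightarrow> 0 \<le> w c" "sum w C = 1" "\<And>c. c \<in> C \<Longrightarrow> k \<le> f c"
  shows "k \<le> (\<Sum>c\<in>C. w c * f c)"
proof -
  have "k = (\<Sum>c\<in>C. w c * k)" using assms(2) by (simp flip: sum_distrib_right)
  also have "\<dots> \<le> (\<Sum>c\<in>C. w c * f c)"
    using assms by (intro sum_mono mult_left_mono) auto
  finally show ?thesis .
qed

text \<open>Because the weights sum to one, the constants \<open>b\<close> can be moved into the
  combination.\<close>

lemma convex_combination_affine: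
  fixes w :: "'c \<Rightarrow> rat" and y :: "'c \<Rightarrow> 'a \<Rightarrow> int" and X :: "'a \<Rightarrow> rat"
  assumes "sum w C = 1" "\<And>a. a \<in> S \<Longrightarrow> X a = (\<Sum>c\<in>C. w c * of_int (y c a))"
  shows "(\<Sum>a\<in>S. X a - of_int (b a)) = (\<Sum>c\<in>C. w c * of_int (\<Sum>a\<in>S. y c a - b a))"
proof -
  have "(\<Sum>a\<in>S. X a - of_int (b a)) = (\<Sum>a\<in>S. \<Sum>c\<in>C. w c * of_int (y c a - b a))"
    using assms by (intro sum.cong)
      (auto simp: right_diff_distrib sum_subtractf simp flip: sum_distrib_right)
  then show ?thesis by (simp add: sum.swap[of _ C S] sum_distrib_left)
qed

text \<open>\<open>\<xi>\<close> depends on \<open>l\<close>, \<open>u\<close>, \<open>F\<close> and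
  \<open>T\<close> but not on \<open>c\<close>; the integral inequalities share their coefficients
  and can be averaged.\<close>

lemma flip_inequality_convex:
  fixes l u :: "'a \<Rightarrow> int" and y :: "'c \<Rightarrow> 'a \<Rightarrow> int" and w :: "'c \<Rightarrow> rat" and T :: nat
  assumes E: "finite E" and T: "T \<ge> 1"
    and w: "\<And>c. c \<in> C \<Longrightarrow> 0 \<le> w c" "sum w C = 1"
    and X: "\<And>a. a \<in> E \<Longrightarrow> X a = (\<Sum>c\<in>C. w c * of_int (y c a))"
    and y: "\<And>c a. c \<in> C \<Longrightarrow> a \<in> E \<Longrightarrow> l a \<le> y c a \<and> y c a \<le> u a"
    and dvd: "\<And>c. c \<in> C \<Longrightarrow> int T dvd (\<Sum>a\<in>E. y c a)"
    and \<xi>: "\<xi> = rat_of_int ((- (\<Sum>a\<in>E - F. l a) - (\<Sum>a\<in>E \<inter> F. u a)) mod int T)"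
  shows "(of_nat T - \<xi>) * (\<Sum>a\<in>E - F. X a - of_int (l a)) + \<xi> * (\<Sum>a\<in>E \<inter> F. of_int (u a) - X a)
    \<ge> \<xi> * (of_nat T - \<xi>)"
proof -
  let ?A = "\<lambda>c. \<Sum>a\<in>E - F. y c a - l a" and ?B = "\<lambda>c. \<Sum>a\<in>E \<inter> F. u a - y c a"
  define k where "k = (- (\<Sum>a\<in>E - F. l a) - (\<Sum>a\<in>E \<inter> F. u a)) mod int T"
  have A: "(\<Sum>a\<in>E - F. X a - of_int (l a)) = (\<Sum>c\<in>C. w c * of_int (?A c))"
    by (rule convex_combination_affine) (use w X in auto)
  \<comment> \<open>The affine lemma subtracts the constant, so the slack to \<open>u\<close> is
    obtained by a change of sign.\<close>
  have "(\<Sum>a\<in>E \<inter> F. X a - of_int (u a)) = (\<Sum>c\<in>C. w c * of_int (\<Sum>a\<in>E \<inter> F. y c a - u a))"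
    by (rule convex_combination_affine) (use w X in auto)
  then have B: "(\<Sum>a\<in>E \<inter> F. of_int (u a) - X a) = (\<Sum>c\<in>C. w c * of_int (?B c))"
    by (simp add: sum_subtractf right_diff_distrib algebra_simps)
  have "of_int (k * (int T - k))
      \<le> (\<Sum>c\<in>C. w c * of_int ((int T - k) * ?A c + k * ?B c))"
  proof (rule convex_combination_ge[OF w])
    fix c assume "c \<in> C"
    with flip_inequality[OF E _ y dvd k_def] T
    show "rat_of_int (k * (int T - k)) \<le> of_int ((int T - k) * ?A c + k * ?B c)"
      by (simp only: of_int_le_iff)
  qed
  also have "\<dots> = (of_nat T - of_int k) * (\<Sum>c\<in>C. w c * of_int (?A c))
      + of_int k * (\<Sum>c\<in>C. w c * of_int (?B c))"
  proof -
    have "(\<Sum>c\<in>C. w c * of_int ((int T - k) * f c + k * g c))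
      = (of_nat T - of_int k) * (\<Sum>c\<in>C. w c * of_int (f c)) + of_int k * (\<Sum>c\<in>C. w c * of_int (g c))"
      for f g
      by (simp add: sum_distrib_left distrib_left sum.distrib mult.left_commute)
    then show ?thesis .
  qed
  finally show ?thesis by (simp add: A B \<xi> k_def)
qed

text \<open>Each integral tension sums to \<open>T\<close> times an integer \<open>k c\<close>, so
  the bounds on \<open>k c\<close> may be rounded before averaging.\<close>

lemma cycle_inequality_convex:
  fixes l u :: "'a \<Rightarrow> int" and y :: "'c \<Rightarrow> 'a \<Rightarrow> int" and w :: "'c \<Rightarrow> rat" and T :: nat
  assumes T: "T \<ge> 1"
    and w: "\<And>c. c \<in> C \<Longrightarrow> 0 \<le> w c" "sum w C = 1"
    and X: "\<And>a. a \<in> E \<Longrightarrow> X a = (\<Sum>c\<in>C. w c * of_int (y c a))"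
    and y: "\<And>c a. c \<in> C \<Longrightarrow> a \<in> E \<Longrightarrow> l a \<le> y c a \<and> y c a \<le> u a"
    and dvd: "\<And>c. c \<in> C \<Longrightarrow> int T dvd (\<Sum>a\<in>E. y c a)"
  shows "of_int \<lceil>rat_of_int (\<Sum>a\<in>E. l a) / of_nat T\<rceil> \<le> (\<Sum>a\<in>E. X a) / of_nat T"
    and "(\<Sum>a\<in>E. X a) / of_nat T \<le> of_int \<lfloor>rat_of_int (\<Sum>a\<in>E. u a) / of_nat T\<rfloor>"
proof -
  define k where "k c = (\<Sum>a\<in>E. y c a) div int T" for c
  have k: "(\<Sum>a\<in>E. y c a) = int T * k c" if "c \<in> C" for c
    using dvd[OF that] by (simp add: k_def)
  have "(\<Sum>a\<in>E. X a) = (\<Sum>c\<in>C. w c * of_int (\<Sum>a\<in>E. y c a))"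
    using convex_combination_affine[OF w(2) X, where S = E and b = "\<lambda>_. 0"] by simp
  also have "\<dots> = (\<Sum>c\<in>C. w c * of_int (int T * k c))"
    using k by simp
  also have "\<dots> = of_nat T * (\<Sum>c\<in>C. w c * of_int (k c))"
    by (simp add: sum_distrib_left mult.left_commute)
  finally have sum_X: "(\<Sum>a\<in>E. X a) / of_nat T = (\<Sum>c\<in>C. w c * of_int (k c))"
    using T by simp
  have bounds: "rat_of_int (\<Sum>a\<in>E. l a) / of_nat T \<le> of_int (k c)"
    "of_int (k c) \<le> rat_of_int (\<Sum>a\<in>E. u a) / of_nat T" if c: "c \<in> C" for c
  proof -
    have "(\<Sum>a\<in>E. l a) \<le> int T * k c" "int T * k c \<le> (\<Sum>a\<in>E. u a)"
      unfolding k[OF c, symmetric] using y c by (auto intro: sum_mono)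
    then have "rat_of_int (\<Sum>a\<in>E. l a) \<le> rat_of_int (int T * k c)"
      "rat_of_int (int T * k c) \<le> rat_of_int (\<Sum>a\<in>E. u a)"
      by (simp_all only: of_int_le_iff)
    then show "rat_of_int (\<Sum>a\<in>E. l a) / of_nat T \<le> of_int (k c)"
      "of_int (k c) \<le> rat_of_int (\<Sum>a\<in>E. u a) / of_nat T"
      using T by (simp_all add: field_simps)
  qed
  show "of_int \<lceil>rat_of_int (\<Sum>a\<in>E. l a) / of_nat T\<rceil> \<le> (\<Sum>a\<in>E. X a) / of_nat T"
    unfolding sum_X using bounds(1) by (intro convex_combination_ge[OF w]) (auto simp: ceiling_le_iff)
  \<comment> \<open>The upper bound is the lower bound for the negated values.\<close>
  have "- of_int \<lfloor>rat_of_int (\<Sum>a\<in>E. u a) / of_nat T\<rfloor> \<le> (\<Sum>c\<in>C. w c * - of_int (k c))"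
    using bounds(2) by (intro convex_combination_ge[OF w]) (auto simp: le_floor_iff)
  then show "(\<Sum>a\<in>E. X a) / of_nat T \<le> of_int \<lfloor>rat_of_int (\<Sum>a\<in>E. u a) / of_nat T\<rfloor>"
    unfolding sum_X by (simp add: sum_negf)
qed

section \<open>Incidence vectors of line cycles and the three inequalities\<close>

lemma pos_part_line_cycle [simp]: "pos_part (line_cycle L) = line_cycle L"
  and neg_part_line_cycle [simp]: "neg_part (line_cycle L) a = 0"
  by (auto simp: pos_part_def neg_part_def line_cycle_def)

text \<open>The ring is left general to cover both integer sums of bounds and rational sums of
  tensions.\<close>

lemma sum_line_cycle:
  fixes f :: "'v activity \<Rightarrow> 'b :: ring_1"
  assumes "finite A"
  shows "(\<Sum>a\<in>A. of_int (line_cycle L a) * f a) = sum f (A \<inter> line_activities L)"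
proof -
  have "(\<Sum>a\<in>A. of_int (line_cycle L a) * f a) = (\<Sum>a\<in>A. if a \<in> line_activities L then f a else 0)"
    by (intro sum.cong) (auto simp: line_cycle_def)
  then show ?thesis using assms by (simp add: sum.inter_restrict)
qed

lemma line_cycle_level_sets:
  "{a \<in> A. line_cycle L a = 1} = A \<inter> line_activities L"
  "{a \<in> A. line_cycle L a = - 1} = {}"
  by (auto simp: line_cycle_def)

theorem theorem5p14:
  fixes G :: "'v pair_pre_digraph" and LL :: "'v list set" and T :: nat
    and l u :: "'v activity \<Rightarrow> int"
    and x :: "'v xarc set \<Rightarrow> rat" and z :: "'v xarc \<Rightarrow> rat"
    and \<pi> :: "'v event \<Rightarrow> rat" and p :: "'v activity \<Rightarrow> rat"
    and X :: "'v activity \<Rightarrow> rat"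
  assumes "line_network G LL"
    and "T \<ge> 1"
    and "\<forall>\<alpha>\<in>activities LL. l \<alpha> \<le> u \<alpha>"
    and "(x, z) \<in> P_cXPESP LL T l u"
    and "(\<pi>, p) = psi LL T l u (phi LL T l u (x, z))"
    and "(\<pi>, p) \<in> P_PESP LL T l u"
    and "X = tension T \<pi> p"
  shows "\<forall>\<gamma>\<in>line_cycles LL.
      (of_int \<lceil>rat_of_int ((\<Sum>a\<in>activities LL. pos_part \<gamma> a * l a)
                        - (\<Sum>a\<in>activities LL. neg_part \<gamma> a * u a)) / of_nat T\<rceil>
         \<le> (\<Sum>a\<in>activities LL. of_int (\<gamma> a) * X a) / of_nat T \<and>
       (\<Sum>a\<in>activities LL. of_int (\<gamma> a) * X a) / of_nat T
         \<le> of_int \<lfloor>rat_of_int ((\<Sum>a\<in>activities LL. pos_part \<gamma> a * u a)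
                        - (\<Sum>a\<in>activities LL. neg_part \<gamma> a * l a)) / of_nat T\<rfloor>) \<and>
      (let \<xi> = rat_of_int ((- (\<Sum>a\<in>activities LL. \<gamma> a * l a)) mod int T) in
         (of_nat T - \<xi>) * (\<Sum>a\<in>activities LL. of_int (pos_part \<gamma> a) * (X a - of_int (l a)))
           + \<xi> * (\<Sum>a\<in>activities LL. of_int (neg_part \<gamma> a) * (X a - of_int (l a)))
         \<ge> \<xi> * (of_nat T - \<xi>)) \<and>
      (\<forall>F\<subseteq>activities LL.
         let \<xi> = rat_of_int ((- (\<Sum>a\<in>activities LL - F. \<gamma> a * l a) - (\<Sum>a\<in>F. \<gamma> a * u a)) mod int T) in
         (of_nat T - \<xi>) * (\<Sum>a | a \<in> activities LL - F \<and> \<gamma> a = 1. X a - of_int (l a))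
           + \<xi> * (\<Sum>a | a \<in> activities LL - F \<and> \<gamma> a = - 1. X a - of_int (l a))
           + \<xi> * (\<Sum>a | a \<in> F \<and> \<gamma> a = 1. of_int (u a) - X a)
           + (of_nat T - \<xi>) * (\<Sum>a | a \<in> F \<and> \<gamma> a = - 1. of_int (u a) - X a)
         \<ge> \<xi> * (of_nat T - \<xi>))"
proof
  fix \<gamma> assume "\<gamma> \<in> line_cycles LL"
  then obtain L where L: "L \<in> LL" and \<gamma>: "\<gamma> = line_cycle L"
    by (auto simp: line_cycles_def)
  interpret line_network G LL by fact
  have lines: "distinct L \<and> 1 < length L" if "L \<in> LL" for L
    using line_path[OF that] line_has_edge[OF that] by (auto simp: vpath_def)
  let ?E = "line_activities L" and ?A = "activities LL" and ?C = "cycles_of_line LL T l u L"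
  have L': "distinct L" "1 < length L" using lines[OF L] by auto
  have fin_E: "finite ?E" using finite_line_activities L'(2) .
  have fin_A: "finite ?A" using finite_activities finite_lines lines by blast
  have "?E \<subseteq> ?A" using L by (auto simp: network_def vehicle_activities_def)
  then have AE: "?A \<inter> ?E = ?E" and AFE: "(?A - F) \<inter> ?E = ?E - F" for F by auto
  have w: "0 \<le> x c" if "c \<in> ?C" for c
    using assms(4) that L by (auto simp: P_cXPESP_def cycles_def)
  have w_sum: "sum x ?C = 1"
    using assms(4) L by (auto simp: P_cXPESP_def)
  have "\<forall>c\<in>?C. \<exists>\<theta>. timed_arc \<theta> ` ?E = c"
    using cycles_of_line_structure(1)[OF L'] by metis
  \<comment> \<open>One timing is chosen for each cycle; the durations under it are the integral
    tensions \<open>y c\<close>.\<close>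
  then obtain \<Theta> where \<Theta>: "timed_arc (\<Theta> c) ` ?E = c" if "c \<in> ?C" for c
    by (auto simp: bchoice_iff)
  define y where "y c \<alpha> = duration T l (timed_arc (\<Theta> c) \<alpha>)" for c \<alpha>
  have X: "X \<alpha> = (\<Sum>c\<in>?C. x c * of_int (y c \<alpha>))" if "\<alpha> \<in> ?E" for \<alpha>
    unfolding assms(7) y_def
    by (rule tension_psi_phi[OF finite_lines lines L assms(2) \<Theta> assms(5) that])
  have y_bounds: "l \<alpha> \<le> y c \<alpha> \<and> y c \<alpha> \<le> u \<alpha>" if c: "c \<in> ?C" and \<alpha>: "\<alpha> \<in> ?E" for c \<alpha>
  proof -
    have "timed_arc (\<Theta> c) \<alpha> \<in> c" using imageI[OF \<alpha>, of "timed_arc (\<Theta> c)"] unfolding \<Theta>[OF c] .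
    then obtain \<beta> where \<beta>: "timed_arc (\<Theta> c) \<alpha> \<in> expanded_arcs T l u \<beta>"
      using cycles_of_line_structure(4)[OF L'] c by blast
    with underlying_expanded_arcs[OF this]
    have "timed_arc (\<Theta> c) \<alpha> \<in> expanded_arcs T l u \<alpha>" by simp
    \<comment> \<open>The residue in the duration is nonnegative, and at most
      \<open>u \<alpha> - l \<alpha>\<close> by the definition of the expanded arcs.\<close>
    with assms(2) show ?thesis
      by (auto simp: y_def duration_timed_arc expanded_arcs_def timed_arc_def)
  qed
  have y_dvd: "int T dvd (\<Sum>\<alpha>\<in>?E. y c \<alpha>)" if "c \<in> ?C" for c
    unfolding y_def
    using cycles_of_line_structure(2,3)[OF L' that] by (rule period_dvd_duration)
  note sums = sum_line_cycle[OF fin_A, of L] sum_line_cycle[OF fin_A, of L, where 'b = int, simplified]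
  note cycle_ineq = cycle_inequality_convex[OF assms(2) w w_sum X y_bounds y_dvd]
  note flip_ineq = flip_inequality_convex[OF fin_E assms(2) w w_sum X y_bounds y_dvd refl]
  have flip: "let \<xi> = rat_of_int ((- (\<Sum>a\<in>?A - F. \<gamma> a * l a) - (\<Sum>a\<in>F. \<gamma> a * u a)) mod int T) in
         (of_nat T - \<xi>) * (\<Sum>a | a \<in> ?A - F \<and> \<gamma> a = 1. X a - of_int (l a))
           + \<xi> * (\<Sum>a | a \<in> ?A - F \<and> \<gamma> a = - 1. X a - of_int (l a))
           + \<xi> * (\<Sum>a | a \<in> F \<and> \<gamma> a = 1. of_int (u a) - X a)
           + (of_nat T - \<xi>) * (\<Sum>a | a \<in> F \<and> \<gamma> a = - 1. of_int (u a) - X a)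
         \<ge> \<xi> * (of_nat T - \<xi>)" if F: "F \<subseteq> ?A" for F
  proof -
    have fin: "finite (?A - F)" "finite F" using F fin_A finite_subset by auto
    have "(\<Sum>a\<in>?A - F. \<gamma> a * l a) = sum l (?E - F)" "(\<Sum>a\<in>F. \<gamma> a * u a) = sum u (?E \<inter> F)"
      using sum_line_cycle[OF fin(1), of L l] sum_line_cycle[OF fin(2), of L u]
      by (simp_all add: \<gamma> AFE Int_commute[of ?E F])
    then show ?thesis
      using flip_ineq[of F]
      unfolding \<gamma> line_cycle_level_sets AFE Let_def by (simp add: Int_commute)
  qed
  have change: "let \<xi> = rat_of_int ((- (\<Sum>a\<in>?A. \<gamma> a * l a)) mod int T) in
         (of_nat T - \<xi>) * (\<Sum>a\<in>?A. of_int (pos_part \<gamma> a) * (X a - of_int (l a)))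
           + \<xi> * (\<Sum>a\<in>?A. of_int (neg_part \<gamma> a) * (X a - of_int (l a)))
         \<ge> \<xi> * (of_nat T - \<xi>)"
    using flip_ineq[of "{}"] by (simp add: \<gamma> sums AE Let_def)
  show "(of_int \<lceil>rat_of_int ((\<Sum>a\<in>?A. pos_part \<gamma> a * l a)
                        - (\<Sum>a\<in>?A. neg_part \<gamma> a * u a)) / of_nat T\<rceil>
         \<le> (\<Sum>a\<in>?A. of_int (\<gamma> a) * X a) / of_nat T \<and>
       (\<Sum>a\<in>?A. of_int (\<gamma> a) * X a) / of_nat T
         \<le> of_int \<lfloor>rat_of_int ((\<Sum>a\<in>?A. pos_part \<gamma> a * u a)
                        - (\<Sum>a\<in>?A. neg_part \<gamma> a * l a)) / of_nat T\<rfloor>) \<and>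
      (let \<xi> = rat_of_int ((- (\<Sum>a\<in>?A. \<gamma> a * l a)) mod int T) in
         (of_nat T - \<xi>) * (\<Sum>a\<in>?A. of_int (pos_part \<gamma> a) * (X a - of_int (l a)))
           + \<xi> * (\<Sum>a\<in>?A. of_int (neg_part \<gamma> a) * (X a - of_int (l a)))
         \<ge> \<xi> * (of_nat T - \<xi>)) \<and>
      (\<forall>F\<subseteq>?A.
         let \<xi> = rat_of_int ((- (\<Sum>a\<in>?A - F. \<gamma> a * l a) - (\<Sum>a\<in>F. \<gamma> a * u a)) mod int T) in
         (of_nat T - \<xi>) * (\<Sum>a | a \<in> ?A - F \<and> \<gamma> a = 1. X a - of_int (l a))
           + \<xi> * (\<Sum>a | a \<in> ?A - F \<and> \<gamma> a = - 1. X a - of_int (l a))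
           + \<xi> * (\<Sum>a | a \<in> F \<and> \<gamma> a = 1. of_int (u a) - X a)
           + (of_nat T - \<xi>) * (\<Sum>a | a \<in> F \<and> \<gamma> a = - 1. of_int (u a) - X a)
         \<ge> \<xi> * (of_nat T - \<xi>))"
  proof (intro conjI allI impI)
    show "of_int \<lceil>rat_of_int ((\<Sum>a\<in>?A. pos_part \<gamma> a * l a)
                        - (\<Sum>a\<in>?A. neg_part \<gamma> a * u a)) / of_nat T\<rceil>
         \<le> (\<Sum>a\<in>?A. of_int (\<gamma> a) * X a) / of_nat T"
      using cycle_ineq(1) by (simp add: \<gamma> sums AE)
    show "(\<Sum>a\<in>?A. of_int (\<gamma> a) * X a) / of_nat T
         \<le> of_int \<lfloor>rat_of_int ((\<Sum>a\<in>?A. pos_part \<gamma> a * u a)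
                        - (\<Sum>a\<in>?A. neg_part \<gamma> a * l a)) / of_nat T\<rfloor>"
      using cycle_ineq(2) by (simp add: \<gamma> sums AE)
  qed (use change flip in blast)+
qed

end
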